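(* Let $\mathcal L$ be an MV-algebra and let $P$ be a prime implication filter of $\mathcal L$ that does not contain all counits of $\mathcal L$. Then there is a prime implication filter $Q$ of $\mathcal L$ that is incomparable to $P$, i.e. $Q\not\subseteq P$ and $P\not\subseteq Q$.
   Context: In an MV-algebra $(\mathcal L,\oplus,\lnot,0)$: $1=\lnot 0$, $x\otimes y=\lnot(\lnot x\oplus\lnot y)$, $x\to y=\lnot x\oplus y$, $x\le y$ iff $x\to y=1$, and $\vee,\wedge$ are the lattice operations for $\le$. An implication filter is a lattice filter (nonempty, upward closed, closed under $\wedge$; possibly all of $\mathcal L$) which is closed under powers $x^n=x\otimes\cdots\otimes x$. A prime implication filter is a proper implication filter $F$ such that $a\vee b\in F$ implies $a\in F$ or $b\in F$. An element $u\in\mathcal L$ is a counit iff $u<1$ and there exists $v<1$ with $u\vee v=1$. *)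

theory Defs
  imports Main
begin

text \<open>
  The underlying set of the MV-algebra is the whole type. The operations carry their own names
  because the order is derived from them and the algebra is in general not an instance of the
  arithmetic type classes.
\<close>

class mv_algebra =
  fixes mv_add :: "'a \<Rightarrow> 'a \<Rightarrow> 'a" (infixl "\<oplus>" 65)
    and mv_neg :: "'a \<Rightarrow> 'a" ("\<^bold>\<not> _" [80] 80)
    and mv_zero :: 'a ("\<zero>")
  assumes mv_add_assoc: "(x \<oplus> y) \<oplus> z = x \<oplus> (y \<oplus> z)"
    and mv_add_commute: "x \<oplus> y = y \<oplus> x"
    and mv_add_zero: "x \<oplus> \<zero> = x"
    and mv_neg_neg: "\<^bold>\<not> (\<^bold>\<not> x) = x"
    and mv_add_neg_zero: "x \<oplus> \<^bold>\<not> \<zero> = \<^bold>\<not> \<zero>"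
    and mv_lukasiewicz: "\<^bold>\<not> (\<^bold>\<not> x \<oplus> y) \<oplus> y = \<^bold>\<not> (\<^bold>\<not> y \<oplus> x) \<oplus> x"
begin

definition mv_one :: 'a ("\<one>")
  where "\<one> = \<^bold>\<not> \<zero>"

definition mv_mult :: "'a \<Rightarrow> 'a \<Rightarrow> 'a" (infixl "\<otimes>" 70)
  where "x \<otimes> y = \<^bold>\<not> (\<^bold>\<not> x \<oplus> \<^bold>\<not> y)"

definition mv_imp :: "'a \<Rightarrow> 'a \<Rightarrow> 'a" (infixr "\<rightarrow>" 60)
  where "x \<rightarrow> y = \<^bold>\<not> x \<oplus> y"

definition mv_le :: "'a \<Rightarrow> 'a \<Rightarrow> bool" (infix "\<preceq>" 50)
  where "x \<preceq> y \<longleftrightarrow> x \<rightarrow> y = \<one>"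

definition mv_less :: "'a \<Rightarrow> 'a \<Rightarrow> bool" (infix "\<prec>" 50)
  where "x \<prec> y \<longleftrightarrow> x \<preceq> y \<and> x \<noteq> y"

text \<open>
  The usual MV-terms for join and meet; the sublocale statement below shows that they are the
  lattice operations of \<open>\<preceq>\<close>.
\<close>

definition mv_join :: "'a \<Rightarrow> 'a \<Rightarrow> 'a" (infixl "\<squnion>" 65)
  where "x \<squnion> y = \<^bold>\<not> (\<^bold>\<not> x \<oplus> y) \<oplus> y"

definition mv_meet :: "'a \<Rightarrow> 'a \<Rightarrow> 'a" (infixl "\<sqinter>" 70)
  where "x \<sqinter> y = \<^bold>\<not> (\<^bold>\<not> x \<squnion> \<^bold>\<not> y)"

lemma mv_zero_add: "\<zero> \<oplus> x = x"
  using mv_add_zero mv_add_commute by metis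

lemma mv_neg_one: "\<^bold>\<not> \<one> = \<zero>"
  by (simp add: mv_one_def mv_neg_neg)

lemma mv_one_add: "\<one> \<oplus> x = \<one>"
  using mv_add_neg_zero mv_add_commute unfolding mv_one_def by metis

lemma mv_neg_add_self: "\<^bold>\<not> x \<oplus> x = \<one>"
  using mv_lukasiewicz[of x \<one>]
  by (simp add: mv_add_neg_zero mv_one_def mv_neg_neg mv_zero_add)

lemma mv_le_iff: "x \<preceq> y \<longleftrightarrow> \<^bold>\<not> x \<oplus> y = \<one>"
  by (simp add: mv_le_def mv_imp_def)

lemma mv_le_iff_add: "x \<preceq> y \<longleftrightarrow> (\<exists>z. y = x \<oplus> z)"
proof
  assume "x \<preceq> y"
  then have "\<^bold>\<not> \<one> \<oplus> y = \<^bold>\<not> (\<^bold>\<not> y \<oplus> x) \<oplus> x"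
    using mv_lukasiewicz[of x y] by (simp add: mv_le_iff)
  then show "\<exists>z. y = x \<oplus> z"
    by (metis mv_neg_one mv_zero_add mv_add_commute)
next
  assume "\<exists>z. y = x \<oplus> z"
  then obtain z where "y = x \<oplus> z" ..
  then have "\<^bold>\<not> x \<oplus> y = (\<^bold>\<not> x \<oplus> x) \<oplus> z" by (simp add: mv_add_assoc)
  then show "x \<preceq> y" by (simp add: mv_le_iff mv_neg_add_self mv_one_add)
qed

lemma mv_le_antisym: "x \<preceq> y \<Longrightarrow> y \<preceq> x \<Longrightarrow> x = y"
  using mv_lukasiewicz[of x y] by (simp add: mv_le_iff mv_neg_one mv_zero_add)

lemma mv_le_trans: "x \<preceq> y \<Longrightarrow> y \<preceq> z \<Longrightarrow> x \<preceq> z"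
  unfolding mv_le_iff_add using mv_add_assoc by metis

lemma mv_add_mono: "x \<preceq> y \<Longrightarrow> x \<oplus> z \<preceq> y \<oplus> z"
  unfolding mv_le_iff_add using mv_add_assoc mv_add_commute by metis

lemma mv_neg_antimono: "x \<preceq> y \<Longrightarrow> \<^bold>\<not> y \<preceq> \<^bold>\<not> x"
  by (simp add: mv_le_iff mv_neg_neg mv_add_commute)

lemma mv_le_join2: "y \<preceq> x \<squnion> y"
  unfolding mv_le_iff_add mv_join_def using mv_add_commute by metis

lemma mv_join_commute: "x \<squnion> y = y \<squnion> x"
  by (simp add: mv_join_def mv_lukasiewicz)

lemma mv_le_join1: "x \<preceq> x \<squnion> y"
  using mv_le_join2 mv_join_commute by metis

lemma mv_join_least:
  assumes "x \<preceq> z" "y \<preceq> z"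
  shows "x \<squnion> y \<preceq> z"
proof -
  have "x \<squnion> y \<preceq> z \<squnion> y"
    unfolding mv_join_def
    using assms(1) by (intro mv_add_mono mv_neg_antimono)
  moreover have "z \<squnion> y = z"
    using assms(2) mv_lukasiewicz[of z y]
    by (simp add: mv_join_def mv_le_iff mv_neg_one mv_zero_add)
  ultimately show ?thesis by simp
qed

sublocale mv: lattice mv_meet mv_le mv_less mv_join
proof
  fix x y z
  show "x \<prec> y \<longleftrightarrow> x \<preceq> y \<and> \<not> y \<preceq> x"
    using mv_le_antisym unfolding mv_less_def by (auto simp: mv_le_iff mv_neg_add_self)
  show "x \<preceq> x" by (simp add: mv_le_iff mv_neg_add_self)
  show "x \<preceq> y \<Longrightarrow> y \<preceq> z \<Longrightarrow> x \<preceq> z" by (rule mv_le_trans)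
  show "x \<preceq> y \<Longrightarrow> y \<preceq> x \<Longrightarrow> x = y" by (rule mv_le_antisym)
  show "x \<preceq> x \<squnion> y" by (rule mv_le_join1)
  show "y \<preceq> x \<squnion> y" by (rule mv_le_join2)
  show "y \<preceq> x \<Longrightarrow> z \<preceq> x \<Longrightarrow> y \<squnion> z \<preceq> x" by (rule mv_join_least)
  show "x \<sqinter> y \<preceq> x"
    using mv_neg_antimono[OF mv_le_join1[of "\<^bold>\<not> x" "\<^bold>\<not> y"]] by (simp add: mv_meet_def mv_neg_neg)
  show "x \<sqinter> y \<preceq> y"
    using mv_neg_antimono[OF mv_le_join2[of "\<^bold>\<not> y" "\<^bold>\<not> x"]] by (simp add: mv_meet_def mv_neg_neg)
  show "x \<preceq> y \<Longrightarrow> x \<preceq> z \<Longrightarrow> x \<preceq> y \<sqinter> z"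
    using mv_neg_antimono[OF mv_join_least[of "\<^bold>\<not> y" "\<^bold>\<not> x" "\<^bold>\<not> z"]]
    by (simp add: mv_meet_def mv_neg_neg mv_neg_antimono)
qed

primrec mv_power :: "'a \<Rightarrow> nat \<Rightarrow> 'a"
  where
    "mv_power x 0 = \<one>"
  | "mv_power x (Suc n) = x \<otimes> mv_power x n"

definition lattice_filter :: "'a set \<Rightarrow> bool"
  where "lattice_filter F \<longleftrightarrow>
    F \<noteq> {} \<and>
    (\<forall>x y. x \<in> F \<longrightarrow> x \<preceq> y \<longrightarrow> y \<in> F) \<and>
    (\<forall>x\<in>F. \<forall>y\<in>F. x \<sqinter> y \<in> F)"

definition implication_filter :: "'a set \<Rightarrow> bool"
  where "implication_filter F \<longleftrightarrow>
    lattice_filter F \<and> (\<forall>x\<in>F. \<forall>n\<ge>1. mv_power x n \<in> F)"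

definition prime_implication_filter :: "'a set \<Rightarrow> bool"
  where "prime_implication_filter F \<longleftrightarrow>
    implication_filter F \<and> F \<noteq> UNIV \<and>
    (\<forall>a b. a \<squnion> b \<in> F \<longrightarrow> a \<in> F \<or> b \<in> F)"

definition counit :: "'a \<Rightarrow> bool"
  where "counit u \<longleftrightarrow> u \<prec> \<one> \<and> (\<exists>v. v \<prec> \<one> \<and> u \<squnion> v = \<one>)"

end

end

theory Submission
  imports Defs
begin

text \<open>
  Let \<open>u \<notin> P\<close> be a counit with witness \<open>v\<close>, so \<open>u \<squnion> v = \<one>\<close> and \<open>v \<noteq> \<one>\<close>. Since \<open>\<one> \<in> P\<close>,
  primality puts \<open>v\<close> into \<open>P\<close>. A prime implication filter \<open>Q\<close> with \<open>u \<in> Q\<close> and \<open>v \<notin> Q\<close> is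
  therefore incomparable to \<open>P\<close>.

  The filter \<open>Q\<close> is found by means of the quotient \<open>(F : a) = {x. a \<squnion> x \<in> F}\<close>, which is
  an implication filter containing \<open>F\<close> whenever \<open>F\<close> is an implication filter
  (\<open>implication_filter_quotient\<close>). The quotient \<open>({\<one>} : v)\<close> contains \<open>u\<close>, and it omits \<open>v\<close>
  because \<open>v \<squnion> v = v\<close>. By Zorn's lemma it extends to an implication filter \<open>Q\<close> that is maximal among those omitting
  \<open>v\<close>, and maximality makes \<open>Q\<close> prime (\<open>prime_extension_avoiding\<close>). Arguing with quotients
  instead of generated filters avoids estimates for products of powers of generators.
\<close>

context mv_algebra
begin

lemma mult_commute: "x \<otimes> y = y \<otimes> x"
  by (simp add: mv_mult_def mv_add_commute)

lemma le_one: "x \<preceq> \<one>"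
  unfolding mv_le_iff using mv_one_add mv_add_commute by metis

lemma mult_one: "x \<otimes> \<one> = x"
  by (simp add: mv_mult_def mv_neg_one mv_add_zero mv_neg_neg)

lemma residuation: "x \<otimes> y \<preceq> z \<longleftrightarrow> x \<preceq> y \<rightarrow> z"
  by (simp add: mv_le_iff mv_mult_def mv_imp_def mv_neg_neg mv_add_assoc)

lemma mult_mono_left:
  assumes "x \<preceq> x'"
  shows "x \<otimes> y \<preceq> x' \<otimes> y"
proof -
  have "x' \<preceq> y \<rightarrow> x' \<otimes> y"
    using residuation mv.order_refl by blast
  with assms have "x \<preceq> y \<rightarrow> x' \<otimes> y"
    by (rule mv_le_trans)
  then show ?thesis by (simp add: residuation)
qed

lemma mult_mono:
  assumes "x \<preceq> x'" "y \<preceq> y'"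
  shows "x \<otimes> y \<preceq> x' \<otimes> y'"
  using mult_mono_left[OF assms(1), of y] mult_mono_left[OF assms(2), of x']
  by (metis mult_commute mv_le_trans)

lemma mult_le_left: "x \<otimes> y \<preceq> x"
  using mult_mono[OF mv.order_refl le_one, of x y] by (simp add: mult_one)

lemma mult_le_right: "x \<otimes> y \<preceq> y"
  using mult_le_left[of y x] by (simp add: mult_commute)

text \<open>
  By residuation, a product of joins lies below a given element as soon as each product of one
  joinand from the left and one from the right does; of the four products here, all but
  \<open>x \<otimes> y\<close> have a factor \<open>a\<close>.
\<close>

lemma join_mult_join_le: "(a \<squnion> x) \<otimes> (a \<squnion> y) \<preceq> a \<squnion> x \<otimes> y"
proof -
  let ?c = "a \<squnion> x \<otimes> y"
  have "a \<otimes> (a \<squnion> y) \<preceq> ?c"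
    using mult_le_left mv_le_join1 mv_le_trans by blast
  moreover have "(a \<squnion> y) \<otimes> x \<preceq> ?c"
  proof -
    have "a \<otimes> x \<preceq> ?c"
      using mult_le_left mv_le_join1 mv_le_trans by blast
    moreover have "y \<otimes> x \<preceq> ?c"
      using mv_le_join2 mult_commute by metis
    ultimately show ?thesis
      unfolding residuation by (rule mv_join_least)
  qed
  ultimately show ?thesis
    unfolding residuation[of "a \<squnion> x"]
    by (intro mv_join_least) (simp_all add: residuation[symmetric] mult_commute)
qed

text \<open>
  Closure under \<open>\<sqinter>\<close> and powers amounts to closure under \<open>\<otimes>\<close>, which is easier to verify,
  because \<open>(x \<sqinter> y)\<^sup>2 \<preceq> x \<otimes> y \<preceq> x \<sqinter> y\<close>.
\<close>

lemma implication_filter_iff: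
  "implication_filter F \<longleftrightarrow>
    \<one> \<in> F \<and> (\<forall>x y. x \<in> F \<longrightarrow> x \<preceq> y \<longrightarrow> y \<in> F) \<and> (\<forall>x\<in>F. \<forall>y\<in>F. x \<otimes> y \<in> F)"
    (is "_ \<longleftrightarrow> ?one \<and> ?up \<and> ?mult")
proof
  assume F: "implication_filter F"
  then have up: ?up
    by (simp add: implication_filter_def lattice_filter_def)
  moreover have ?one
    using F le_one unfolding implication_filter_def lattice_filter_def by blast
  moreover have ?mult
  proof (intro ballI)
    fix x y assume "x \<in> F" "y \<in> F"
    then have "x \<sqinter> y \<in> F"
      using F by (simp add: implication_filter_def lattice_filter_def)
    then have "mv_power (x \<sqinter> y) 2 \<in> F"
      using F by (simp add: implication_filter_def)
    then have "(x \<sqinter> y) \<otimes> (x \<sqinter> y) \<in> F"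
      by (simp add: numeral_2_eq_2 mult_one)
    moreover have "(x \<sqinter> y) \<otimes> (x \<sqinter> y) \<preceq> x \<otimes> y"
      by (rule mult_mono[OF mv.inf_le1 mv.inf_le2])
    ultimately show "x \<otimes> y \<in> F" using up by blast
  qed
  ultimately show "?one \<and> ?up \<and> ?mult" by blast
next
  assume F: "?one \<and> ?up \<and> ?mult"
  have "x \<sqinter> y \<in> F" if "x \<in> F" "y \<in> F" for x y
    using F that mv.inf_greatest[OF mult_le_left mult_le_right] by blast
  moreover have "mv_power x n \<in> F" if "x \<in> F" for x n
    using F that by (induction n) auto
  ultimately show "implication_filter F"
    using F unfolding implication_filter_def lattice_filter_def by blast
qed

lemma implication_filter_one: "implication_filter {\<one>}"
  unfolding implication_filter_iff
  using mult_one mv_le_antisym[OF le_one] by auto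

lemma implication_filter_quotient:
  assumes "implication_filter F"
  shows "implication_filter {x. a \<squnion> x \<in> F}" and "F \<subseteq> {x. a \<squnion> x \<in> F}"
proof -
  have one: "\<one> \<in> F"
    and up: "\<And>x y. x \<in> F \<Longrightarrow> x \<preceq> y \<Longrightarrow> y \<in> F"
    and mult: "\<And>x y. x \<in> F \<Longrightarrow> y \<in> F \<Longrightarrow> x \<otimes> y \<in> F"
    using assms unfolding implication_filter_iff by blast+
  show "F \<subseteq> {x. a \<squnion> x \<in> F}"
    using up mv_le_join2 by blast
  then show "implication_filter {x. a \<squnion> x \<in> F}"
    unfolding implication_filter_iff
    using one up[OF _ mv.sup.mono[OF mv.order_refl]] up[OF mult join_mult_join_le] by auto
qed

lemma implication_filter_Union_chain:
  assumes "C \<noteq> {}" "subset.chain {F. implication_filter F} C"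
  shows "implication_filter (\<Union>C)"
proof -
  have filt: "implication_filter F" if "F \<in> C" for F
    using assms(2) that unfolding subset.chain_def by blast
  have "x \<otimes> y \<in> \<Union>C" if xy: "x \<in> \<Union>C" "y \<in> \<Union>C" for x y
  proof -
    obtain F G where FG: "F \<in> C" "x \<in> F" "G \<in> C" "y \<in> G"
      using xy by blast
    then have "F \<subseteq> G \<or> G \<subseteq> F"
      using assms(2) unfolding subset_chain_def by blast
    then obtain H where "H \<in> C" "x \<in> H" "y \<in> H"
      using FG by blast
    then show ?thesis
      using filt unfolding implication_filter_iff by blast
  qed
  then show ?thesis
    using assms(1) filt unfolding implication_filter_iff by blast
qed

lemma maximal_avoiding_prime:
  assumes Q: "implication_filter Q" "v \<notin> Q"
    and maximal: "\<And>F. implication_filter F \<Longrightarrow> v \<notin> F \<Longrightarrow> Q \<subseteq> F \<Longrightarrow> F = Q"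
  shows "prime_implication_filter Q"
proof -
  have "a \<in> Q" if ab: "a \<squnion> b \<in> Q" and b: "b \<notin> Q" for a b
  proof -
    \<comment> \<open>The quotient by \<open>a\<close> contains \<open>b\<close>, so it is strictly larger than \<open>Q\<close> and must contain \<open>v\<close>.\<close>
    have "v \<in> {x. a \<squnion> x \<in> Q}"
      using maximal[OF implication_filter_quotient(1)[OF Q(1)] _ implication_filter_quotient(2)[OF Q(1)]]
        ab b by blast
    then have "a \<in> {x. v \<squnion> x \<in> Q}"
      by (simp add: mv_join_commute)
    \<comment> \<open>The quotient by \<open>v\<close> omits \<open>v\<close>, because \<open>v \<squnion> v = v \<notin> Q\<close>, and hence equals \<open>Q\<close>.\<close>
    moreover have "{x. v \<squnion> x \<in> Q} = Q"
      using Q by (intro maximal implication_filter_quotient) simp_all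
    ultimately show ?thesis by simp
  qed
  then show ?thesis
    using Q unfolding prime_implication_filter_def by blast
qed

lemma prime_extension_avoiding:
  assumes "implication_filter F" "v \<notin> F"
  shows "\<exists>Q. prime_implication_filter Q \<and> F \<subseteq> Q \<and> v \<notin> Q"
proof -
  define A where "A = {G. implication_filter G \<and> F \<subseteq> G \<and> v \<notin> G}"
  have "\<exists>Q\<in>A. \<forall>G\<in>A. Q \<subseteq> G \<longrightarrow> G = Q"
  proof (rule subset_Zorn_nonempty)
    show "A \<noteq> {}"
      using assms by (auto simp: A_def)
    fix C assume C: "C \<noteq> {}" "subset.chain A C"
    then have "subset.chain {G. implication_filter G} C" "C \<subseteq> A"
      by (auto simp: subset_chain_def A_def)
    then show "\<Union>C \<in> A"
      using C(1) implication_filter_Union_chain by (auto simp: A_def)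
  qed
  then obtain Q where Q: "Q \<in> A" and maximal: "\<forall>G\<in>A. Q \<subseteq> G \<longrightarrow> G = Q"
    by blast
  have "prime_implication_filter Q"
  proof (rule maximal_avoiding_prime)
    show "implication_filter Q" "v \<notin> Q"
      using Q by (simp_all add: A_def)
    show "G = Q" if "implication_filter G" "v \<notin> G" "Q \<subseteq> G" for G
      using that Q maximal by (auto simp: A_def)
  qed
  then show ?thesis
    using Q by (auto simp: A_def)
qed

end

theorem proposition2p5:
  fixes P :: "'a::mv_algebra set"
  assumes "prime_implication_filter P"
    and "\<not> {u. counit u} \<subseteq> P"
  shows "\<exists>Q :: 'a set. prime_implication_filter Q \<and> \<not> Q \<subseteq> P \<and> \<not> P \<subseteq> Q"
proof -
  obtain u v :: 'a where u: "u \<notin> P" and v: "v \<noteq> \<one>" and uv: "u \<squnion> v = \<one>"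
    using assms(2) by (auto simp: counit_def mv_less_def)
  have "\<one> \<in> P"
    using assms(1) by (simp add: prime_implication_filter_def implication_filter_iff)
  then have "v \<in> P"
    using assms(1) u uv unfolding prime_implication_filter_def by metis
  have "implication_filter {x. v \<squnion> x \<in> {\<one>}}"
    by (rule implication_filter_quotient(1)[OF implication_filter_one])
  moreover have "v \<notin> {x. v \<squnion> x \<in> {\<one>}}"
    using v by simp
  ultimately obtain Q where Q: "prime_implication_filter Q" "{x. v \<squnion> x \<in> {\<one>}} \<subseteq> Q" "v \<notin> Q"
    using prime_extension_avoiding by blast
  have "u \<in> Q"
    using Q(2) uv by (auto simp: mv_join_commute)
  then show ?thesis
    using Q u \<open>v \<in> P\<close> by blast
qed

end
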